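(* Let $p,q\in\mathbb{Z}$ with $\min\{p+q,\,p-q\}\geq 0$. Then \[ \frac{2(-1)^q}{3^{3q-\frac{1}{2}}\,\pi}=\Big(\frac{1}{2}\Big)_{p+2q} \sum_{k=0}^{\infty}\frac{(\frac{1}{2})_{k+3p}(\frac{1}{2})_{k+3q}(\frac{1}{2})_{2k-3q}} {k!\,(k+p-q)!\,(2k+3p+3q)!}\cdot\frac{8k+6p+1}{9^k}. \]
   Context: For a complex number $x$ and an integer $n$ (possibly negative), the shifted factorial is defined by $(x)_n=\Gamma(x+n)/\Gamma(x)$, where $\Gamma$ is the Gamma function. *)

theory Defs
  imports "HOL-Analysis.Analysis"
begin

text \<open>
  The library's \<open>pochhammer\<close> only covers natural-number indices. Since \<open>Gamma\<close> is \<open>0\<close> at its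
  poles and division by zero is \<open>0\<close>, the definition is meaningful only if neither \<open>x\<close> nor
  \<open>x + of_int n\<close> is a non-positive integer, which always holds for \<open>x = 1/2\<close>.
\<close>

definition shifted_factorial :: "complex \<Rightarrow> int \<Rightarrow> complex" where
  "shifted_factorial x n = Gamma (x + of_int n) / Gamma x"

end

(* For fixed q the series does not depend on p: in WZ fashion, the difference of the summands for
   p + 1 and p is the forward difference in k of a companion term that vanishes at k = 0 and tends
   to 0 as k tends to infinity. So the value of the series is its limit as p tends to infinity.
   There the terms with k >= 1 are negligible, the ratio of consecutive terms being at most 8/9 for
   large p and tending to 0 at k = 0, while the term at k = 0 is evaluated by the asymptotics of the
   Gamma function and the reflection formula. *)

theory Submission
  imports Defs "HOL-Real_Asymp.Real_Asymp"
begin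

section \<open>Gamma function at half-integers\<close>

text \<open>Equals \<open>sqrt pi\<close> times (1/2)_n, as a real number. The whole computation
  runs over the reals with this normalisation; complex numbers return only at the end.\<close>

definition gamma_half :: "int \<Rightarrow> real" where
  "gamma_half n = Gamma (of_int n + 1/2)"

text \<open>A parity argument. It keeps every Gamma argument away from the poles, so that
  nonvanishing and the recurrences below hold at negative indices too.\<close>

lemma of_int_plus_half_notin_nonpos_Ints: "of_int n + 1/2 \<notin> (\<int>\<^sub>\<le>\<^sub>0 :: real set)"
proof
  assume "of_int n + 1/2 \<in> (\<int>\<^sub>\<le>\<^sub>0 :: real set)"
  then obtain m :: int where "of_int n + 1/2 = (of_int m :: real)"
    by (auto elim: nonpos_Ints_cases)
  hence "of_int (2 * n + 1) = (of_int (2 * m) :: real)"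
    by simp
  hence "2 * n + 1 = 2 * m"
    by (simp only: of_int_eq_iff)
  thus False
    by presburger
qed

lemma gamma_half_nonzero: "gamma_half n \<noteq> 0"
  by (simp add: gamma_half_def Gamma_eq_zero_iff of_int_plus_half_notin_nonpos_Ints)

lemma gamma_half_plus1: "gamma_half (n + 1) = (of_int n + 1/2) * gamma_half n"
  using Gamma_plus1[OF of_int_plus_half_notin_nonpos_Ints[of n]]
  by (simp add: gamma_half_def add_ac)

lemma gamma_half_plus2:
  "gamma_half (n + 2) = (of_int n + 3/2) * (of_int n + 1/2) * gamma_half n"
  using gamma_half_plus1[of "n + 1"] gamma_half_plus1[of n] by (simp add: add_ac)

lemma gamma_half_plus3:
  "gamma_half (n + 3) = (of_int n + 5/2) * (of_int n + 3/2) * (of_int n + 1/2) * gamma_half n"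
  using gamma_half_plus1[of "n + 2"] gamma_half_plus2[of n] by (simp add: add_ac)

text \<open>Euler's reflection formula at x = n + 1/2, where 1 - x = -n + 1/2 and sin (pi x) =
  (-1)^n. The complex version is pulled back along \<open>of_real\<close>.\<close>

lemma gamma_half_reflection: "gamma_half n * gamma_half (- n) = pi * (-1) powi n"
proof -
  let ?x = "of_int n + 1/2 :: real"
  have "complex_of_real (Gamma ?x * Gamma (1 - ?x)) = of_real (pi / sin (pi * ?x))"
    using Gamma_reflection_complex[of "of_real ?x"]
    by (simp only: of_real_mult of_real_divide sin_of_real [symmetric]
        Gamma_complex_of_real [symmetric] of_real_diff of_real_1)
  hence "Gamma ?x * Gamma (1 - ?x) = pi / sin (pi * ?x)"
    by (simp only: of_real_eq_iff)
  moreover have "sin (pi * ?x) = (-1) powi n"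
    by (simp add: distrib_left sin_add power_int_minus_left)
  ultimately show ?thesis
    by (simp add: gamma_half_def power_int_minus_left)
qed

text \<open>\<open>nat\<close> truncates: at n = -1 the left side is 1 and the right side 0. Below,
  \<bar>q\<bar> \<le> p makes all the factorial arguments nonnegative.\<close>

lemma fact_nat_plus1:
  assumes "n \<ge> 0"
  shows "fact (nat (n + 1)) = (of_int n + 1) * (fact (nat n) :: real)"
proof -
  have "nat (n + 1) = Suc (nat n)"
    using assms by simp
  thus ?thesis
    using assms by (simp add: add_ac)
qed

lemma fact_nat_plus2:
  assumes "n \<ge> 0"
  shows "fact (nat (n + 2)) = (of_int n + 2) * (of_int n + 1) * (fact (nat n) :: real)"
  using fact_nat_plus1[of "n + 1"] fact_nat_plus1[of n] assms by (simp add: add_ac)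

lemma fact_nat_plus3:
  assumes "n \<ge> 0"
  shows "fact (nat (n + 3)) = (of_int n + 3) * (of_int n + 2) * (of_int n + 1) * (fact (nat n) :: real)"
  using fact_nat_plus1[of "n + 2"] fact_nat_plus2[of n] assms by (simp add: add_ac)

section \<open>The WZ pair and its certificate\<close>

text \<open>The prefactor (1/2)_{p+2q} of the theorem is absorbed here, since only with it is the
  sum independent of p. Powers of \<open>sqrt pi\<close> are dropped, and the linear weight is kept
  apart because the companion shares the remaining factors.\<close>

definition base_term :: "int \<Rightarrow> int \<Rightarrow> nat \<Rightarrow> real" where
  "base_term p q k = gamma_half (p + 2 * q) * gamma_half (int k + 3 * p)
      * gamma_half (int k + 3 * q) * gamma_half (2 * int k - 3 * q)
      / (fact k * fact (nat (int k + p - q)) * fact (nat (2 * int k + 3 * p + 3 * q)) * 9 ^ k)"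

definition summand :: "int \<Rightarrow> int \<Rightarrow> nat \<Rightarrow> real" where
  "summand p q k = base_term p q k * (8 * real k + 6 * of_int p + 1)"

text \<open>The rational factor comes from applying Gosper's algorithm in \<open>k\<close> to
  \<open>summand (p + 1) q k - summand p q k\<close>.\<close>

definition companion :: "int \<Rightarrow> int \<Rightarrow> nat \<Rightarrow> real" where
  "companion p q k = base_term p q k * (9 * real k * (2 * real k + 4 * of_int p + 2 * of_int q + 1)
      / (2 * real k + 3 * of_int p + 3 * of_int q + 1))"

text \<open>The quotient of consecutive values of \<open>base_term\<close> in k, as a rational
  function of real variables, ready for limits and estimates.\<close>

definition ratio :: "real \<Rightarrow> real \<Rightarrow> real \<Rightarrow> real" where
  "ratio p q k = (k + 3 * p + 1/2) * (k + 3 * q + 1/2) * (2 * k - 3 * q + 1/2) * (2 * k - 3 * q + 3/2)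
      / (9 * (k + 1) * (k + p - q + 1) * (2 * k + 3 * p + 3 * q + 1) * (2 * k + 3 * p + 3 * q + 2))"

lemma base_term_Suc:
  assumes "\<bar>q\<bar> \<le> p"
  shows "base_term p q (Suc k) = ratio (of_int p) (of_int q) (real k) * base_term p q k"
proof -
  have 1: "int (Suc k) + 3 * p = (int k + 3 * p) + 1" "int (Suc k) + 3 * q = (int k + 3 * q) + 1"
    "2 * int (Suc k) - 3 * q = (2 * int k - 3 * q) + 2"
    "int (Suc k) + p - q = (int k + p - q) + 1"
    "2 * int (Suc k) + 3 * p + 3 * q = (2 * int k + 3 * p + 3 * q) + 2"
    by simp_all
  have 2: "int k + p - q \<ge> 0" "2 * int k + 3 * p + 3 * q \<ge> 0"
    using assms by linarith+
  show ?thesis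
    unfolding base_term_def ratio_def 1 gamma_half_plus1 gamma_half_plus2
      fact_nat_plus1[OF 2(1)] fact_nat_plus2[OF 2(2)]
    by (simp add: mult_ac add_ac) (simp add: algebra_simps)
qed

lemma base_term_shift:
  assumes "\<bar>q\<bar> \<le> p"
  defines "P \<equiv> real_of_int p" and "Q \<equiv> real_of_int q"
  shows "base_term (p + 1) q k = base_term p q k *
    ((P + 2*Q + 1/2) * (k + 3*P + 1/2) * (k + 3*P + 3/2) * (k + 3*P + 5/2)
      / ((k + P - Q + 1) * (2*k + 3*P + 3*Q + 1) * (2*k + 3*P + 3*Q + 2) * (2*k + 3*P + 3*Q + 3)))"
proof -
  have 1: "p + 1 + 2 * q = (p + 2 * q) + 1" "int k + 3 * (p + 1) = (int k + 3 * p) + 3"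
    "int k + (p + 1) - q = (int k + p - q) + 1"
    "2 * int k + 3 * (p + 1) + 3 * q = (2 * int k + 3 * p + 3 * q) + 3"
    by simp_all
  have 2: "int k + p - q \<ge> 0" "2 * int k + 3 * p + 3 * q \<ge> 0"
    using assms by linarith+
  show ?thesis
    unfolding base_term_def 1 gamma_half_plus1 gamma_half_plus3
      fact_nat_plus1[OF 2(1)] fact_nat_plus3[OF 2(2)] P_def Q_def
    by (simp add: mult_ac add_ac)
qed

text \<open>The WZ equation after division by \<open>base_term p q k\<close> and multiplication by
  the common denominator: a polynomial identity.\<close>

lemma certificate_identity:
  fixes k p q :: real
  shows "(8*k + 6*p + 7) * ((p + 2*q + 1/2) * (k + 3*p + 1/2) * (k + 3*p + 3/2) * (k + 3*p + 5/2))
    - (8*k + 6*p + 1) * ((k + p - q + 1) * (2*k + 3*p + 3*q + 1) * (2*k + 3*p + 3*q + 2) * (2*k + 3*p + 3*q + 3))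
    = (k + 3*p + 1/2) * (k + 3*q + 1/2) * (2*k - 3*q + 1/2) * (2*k - 3*q + 3/2) * (2*k + 4*p + 2*q + 3)
    - 9 * k * (2*k + 4*p + 2*q + 1) * ((k + p - q + 1) * (2*k + 3*p + 3*q + 2) * (2*k + 3*p + 3*q + 3))"
  by algebra

lemma summand_diff_eq_companion_diff:
  assumes "\<bar>q\<bar> \<le> p"
  shows "summand (p + 1) q k - summand p q k = companion p q (Suc k) - companion p q k"
proof -
  define P Q K where "P = real_of_int p" and "Q = real_of_int q" and "K = real k"
  have pos: "\<bar>Q\<bar> \<le> P" "K \<ge> 0"
    using assms unfolding P_def Q_def K_def by (simp_all flip: of_int_abs)
  \<comment> \<open>The linear factors of the common denominator, all positive because \<bar>q\<bar>
    \<le> p.\<close>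
  define a b c d where "a = K + P - Q + 1" and "b = 2*K + 3*P + 3*Q + 1"
    and "c = 2*K + 3*P + 3*Q + 2" and "d = 2*K + 3*P + 3*Q + 3"
  have nz: "a \<noteq> 0" "b \<noteq> 0" "c \<noteq> 0" "d \<noteq> 0" "K + 1 \<noteq> 0"
    using pos unfolding a_def b_def c_def d_def by linarith+
  define u v w where "u = (P + 2*Q + 1/2) * (K + 3*P + 1/2) * (K + 3*P + 3/2) * (K + 3*P + 5/2)"
    and "v = (K + 3*P + 1/2) * (K + 3*Q + 1/2) * (2*K - 3*Q + 1/2) * (2*K - 3*Q + 3/2)"
    and "w = 2*K + 4*P + 2*Q + 3"
  have id: "(8*K + 6*P + 7) * u - (8*K + 6*P + 1) * (a * b * c * d)
      = v * w - 9 * K * (w - 2) * (a * c * d)"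
    using certificate_identity[of K P Q]
    unfolding a_def b_def c_def d_def u_def v_def w_def by (simp add: add_ac)
  have shift: "summand (p + 1) q k = base_term p q k * (u / (a * b * c * d)) * (8*K + 6*P + 7)"
    unfolding summand_def base_term_shift[OF assms] a_def b_def c_def d_def u_def P_def Q_def K_def
    by (simp add: algebra_simps)
  have succ: "companion p q (Suc k) = base_term p q k * (v / (9 * (K + 1) * a * b * c)) * (9 * (K + 1) * w / d)"
    unfolding companion_def base_term_Suc[OF assms] ratio_def
      a_def b_def c_def d_def v_def w_def P_def Q_def K_def
    by (simp add: algebra_simps)
  have this_k: "companion p q k = base_term p q k * (9 * K * (w - 2) / b)"
    unfolding companion_def b_def w_def P_def Q_def K_def by simp
  have left: "u / (a * b * c * d) * (8*K + 6*P + 7) - (8*K + 6*P + 1)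
      = ((8*K + 6*P + 7) * u - (8*K + 6*P + 1) * (a * b * c * d)) / (a * b * c * d)"
    using nz by (simp add: diff_divide_distrib mult_ac)
  have right: "v / (9 * (K + 1) * a * b * c) * (9 * (K + 1) * w / d) - 9 * K * (w - 2) / b
      = (v * w - 9 * K * (w - 2) * (a * c * d)) / (a * b * c * d)"
  proof -
    have "v / (9 * (K + 1) * a * b * c) * (9 * (K + 1) * w / d) = v * w / (a * b * c * d)"
      "9 * K * (w - 2) / b = 9 * K * (w - 2) * (a * c * d) / (a * b * c * d)"
      using nz by (simp_all add: divide_simps)
    thus ?thesis
      by (simp only: diff_divide_distrib)
  qed
  \<comment> \<open>With \<open>base_term p q k\<close> factored out of both sides,
    \<open>left\<close> and \<open>right\<close> have the same denominator and \<open>id\<close>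
    equates their numerators.\<close>
  have "summand (p + 1) q k - base_term p q k * (8*K + 6*P + 1)
      = companion p q (Suc k) - companion p q k"
    unfolding shift succ this_k mult.assoc [of "base_term p q k"] right_diff_distrib [symmetric]
    unfolding left right id ..
  thus ?thesis
    by (simp add: summand_def[of p] P_def K_def)
qed

section \<open>Convergence and independence of p\<close>

lemma summand_Suc:
  assumes "\<bar>q\<bar> \<le> p"
  shows "summand p q (Suc k) = ratio (of_int p) (of_int q) (real k)
    * ((8 * real k + 6 * of_int p + 9) / (8 * real k + 6 * of_int p + 1)) * summand p q k"
proof -
  have "8 * real k + 6 * real_of_int p + 1 > 0"
    using assms by (simp add: add_nonneg_pos)
  moreover have "8 * real (Suc k) + 6 * real_of_int p + 1 = 8 * real k + 6 * real_of_int p + 9"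
    by simp
  ultimately show ?thesis
    unfolding summand_def base_term_Suc[OF assms] by simp
qed

lemma summable_summand:
  assumes "\<bar>q\<bar> \<le> p"
  shows "summable (summand p q)"
proof -
  define P Q where "P = real_of_int p" and "Q = real_of_int q"
  define r where "r k = ratio P Q (real k) * ((8 * real k + 6 * P + 9) / (8 * real k + 6 * P + 1))" for k
  \<comment> \<open>The leading coefficients in k are 4 and 36. The bound 2/9 used below could be
    any number strictly between 1/9 and 1.\<close>
  have "r \<longlonglongrightarrow> 1/9"
    unfolding r_def ratio_def by real_asymp
  hence "eventually (\<lambda>k. dist (r k) (1/9) < 1/9) sequentially"
    by (rule tendstoD) simp
  then obtain N where N: "\<And>k. k \<ge> N \<Longrightarrow> dist (r k) (1/9) < 1/9"
    by (auto simp: eventually_at_top_linorder)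
  show ?thesis
  proof (rule summable_ratio_test[of "2/9" N])
    fix k assume "k \<ge> N"
    hence "\<bar>r k\<bar> \<le> 2/9"
      using N[of k] unfolding dist_real_def by linarith
    thus "norm (summand p q (Suc k)) \<le> 2/9 * norm (summand p q k)"
      by (simp add: summand_Suc[OF assms] r_def P_def Q_def abs_mult mult_right_mono
          del: times_divide_eq_left times_divide_eq_right)
  qed simp
qed

text \<open>The rational factor grows at most linearly in k, like the weight of
  \<open>summand\<close>. So the companion is dominated by a constant multiple of the summand, which
  tends to 0 by summability.\<close>

lemma companion_tendsto_0:
  assumes "\<bar>q\<bar> \<le> p"
  shows "companion p q \<longlonglongrightarrow> 0"
proof (rule Lim_null_comparison)
  show "(\<lambda>k. 2 * (1 + real_of_int (p - q)) * \<bar>summand p q k\<bar>) \<longlonglongrightarrow> 0"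
    using summable_LIMSEQ_zero[OF summable_summand[OF assms]]
    by (intro tendsto_mult_right_zero tendsto_rabs_zero)
  show "eventually (\<lambda>k. norm (companion p q k) \<le> 2 * (1 + real_of_int (p - q)) * \<bar>summand p q k\<bar>) sequentially"
  proof (intro always_eventually allI)
    fix k
    define P Q K where "P = real_of_int p" and "Q = real_of_int q" and "K = real k"
    have pos: "\<bar>Q\<bar> \<le> P" "K \<ge> 0"
      using assms unfolding P_def Q_def K_def by (simp_all flip: of_int_abs)
    define s where "s = 2 * K + 3 * P + 3 * Q"
    have s: "s \<ge> 0"
      using pos by (simp add: s_def)
    define X where "X = (2 * K + 4 * P + 2 * Q + 1) / (s + 1)"
    have "0 \<le> 2 * K + 4 * P + 2 * Q + 1"
      using pos by linarith
    hence 1: "X \<ge> 0"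
      using s by (simp add: X_def)
    \<comment> \<open>The numerator of \<open>X\<close> exceeds its denominator by P - Q \<ge> 0,
      and the denominator is at least 1; hence the constant 1 + (P - Q).\<close>
    have "2 * K + 4 * P + 2 * Q + 1 = s + 1 + (P - Q) * 1"
      by (simp add: s_def)
    also have "\<dots> \<le> s + 1 + (P - Q) * (s + 1)"
      using pos s by (intro add_left_mono mult_left_mono) auto
    also have "\<dots> = (1 + (P - Q)) * (s + 1)"
      by (simp add: algebra_simps)
    finally have 2: "X \<le> 1 + (P - Q)"
      using s by (simp add: X_def divide_le_eq)
    have "9 * K * X \<le> (2 * (8 * K + 6 * P + 1)) * (1 + (P - Q))"
      using pos 1 2 by (intro mult_mono[of "9 * K" _ X]) (auto simp: distrib_left)
    moreover have "0 \<le> 9 * K * X"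
      using pos 1 by simp
    ultimately have "\<bar>9 * K * X\<bar> \<le> 2 * (1 + (P - Q)) * \<bar>8 * K + 6 * P + 1\<bar>"
      using pos by (simp add: algebra_simps)
    hence "\<bar>base_term p q k\<bar> * \<bar>9 * K * X\<bar>
        \<le> \<bar>base_term p q k\<bar> * (2 * (1 + (P - Q)) * \<bar>8 * K + 6 * P + 1\<bar>)"
      by (intro mult_left_mono) auto
    thus "norm (companion p q k) \<le> 2 * (1 + real_of_int (p - q)) * \<bar>summand p q k\<bar>"
      by (simp add: companion_def summand_def abs_mult X_def s_def P_def Q_def K_def mult_ac)
  qed
qed

text \<open>Summing the WZ equation over k telescopes: the companion has a factor k, so it vanishes
  at k = 0, and it tends to 0 at infinity.\<close>

lemma suminf_summand_shift:
  assumes "\<bar>q\<bar> \<le> p"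
  shows "suminf (summand (p + 1) q) = suminf (summand p q)"
proof -
  have "(\<lambda>k. companion p q (Suc k) - companion p q k) sums (0 - companion p q 0)"
    by (rule telescope_sums[OF companion_tendsto_0[OF assms]])
  hence "(\<lambda>k. summand (p + 1) q k - summand p q k) sums 0"
    by (simp add: summand_diff_eq_companion_diff[OF assms] companion_def)
  moreover have "(\<lambda>k. summand (p + 1) q k - summand p q k) sums
      (suminf (summand (p + 1) q) - suminf (summand p q))"
    using assms by (intro sums_diff summable_sums summable_summand) auto
  ultimately show ?thesis
    using sums_unique2 by fastforce
qed

lemma suminf_summand_add:
  assumes "\<bar>q\<bar> \<le> p"
  shows "suminf (summand (p + int n) q) = suminf (summand p q)"
proof (induction n)
  case (Suc n)
  have "suminf (summand (p + int n + 1) q) = suminf (summand (p + int n) q)"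
    using assms by (intro suminf_summand_shift) auto
  with Suc show ?case
    by (simp add: add_ac)
qed simp

section \<open>Geometric bound on the tail for large p\<close>

text \<open>Factors of the numerator are matched with factors of the denominator, at the cost of
  constants 2, 1, 2 and 2, whose product 8 is set against the 9 in the denominator. The parameter
  \<open>n\<close> stands for \<bar>q\<bar> + 1.\<close>

lemma abs_ratio_le:
  fixes p q k n :: real
  assumes n: "1 \<le> n" "\<bar>q\<bar> \<le> n - 1" and p: "9 * n^2 + n \<le> p" and k: "0 \<le> k"
  shows "\<bar>ratio p q k * ((8 * k + 6 * p + 9) / (8 * k + 6 * p + 1))\<bar> \<le> 8/9"
proof -
  have "n \<le> n^2"
    using n by (simp add: power2_eq_square)
  hence p10: "10 * n \<le> p"
    using p by linarith
  have q: "q \<le> n - 1" "- q \<le> n - 1"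
    using n by linarith+
  define s where "s = 2 * k + 3 * p + 3 * q"
  have a: "\<bar>k + 3 * p + 1/2\<bar> \<le> 2 * (s + 2)"
    using n(1) q p10 k unfolding s_def by (intro abs_leI; (simp only: distrib_left right_diff_distrib)?; linarith)
  have b1: "\<bar>k + 3 * q + 1/2\<bar> \<le> k + 3 * n"
    using n(1) q k by (intro abs_leI; (simp only: distrib_left right_diff_distrib)?; linarith)
  have b2: "\<bar>2 * k - 3 * q + 1/2\<bar> \<le> 2 * k + 3 * n"
    using n(1) q k by (intro abs_leI; (simp only: distrib_left right_diff_distrib)?; linarith)
  \<comment> \<open>At k = 0 no absolute multiple of k + 1 bounds the first factor for all q, so the
    two factors are estimated together.\<close>
  have "\<bar>(k + 3 * q + 1/2) * (2 * k - 3 * q + 1/2)\<bar> \<le> (k + 3 * n) * (2 * k + 3 * n)"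
    unfolding abs_mult using n(1) k by (intro mult_mono b1 b2) auto
  also have "\<dots> = 2 * k^2 + k * (9 * n) + 9 * n^2"
    by (simp add: power2_eq_square algebra_simps)
  also have "\<dots> \<le> 2 * k^2 + k * (9 * n^2 + 2) + 9 * n^2"
    using \<open>n \<le> n^2\<close> k by (intro add_mono mult_left_mono) auto
  also have "\<dots> = (k + 1) * (2 * k + 9 * n^2)"
    by (simp add: power2_eq_square algebra_simps)
  \<comment> \<open>Here the size of p enters: p + q \<ge> 9n^2 + 1, so s + 1 exceeds 2k +
    9n^2.\<close>
  also have "\<dots> \<le> (k + 1) * (s + 1)"
    using n(1) q p k \<open>n \<le> n^2\<close> unfolding s_def by (intro mult_left_mono) linarith+
  finally have b: "\<bar>(k + 3 * q + 1/2) * (2 * k - 3 * q + 1/2)\<bar> \<le> (k + 1) * (s + 1)" .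
  have c: "\<bar>2 * k - 3 * q + 3/2\<bar> \<le> 2 * (k + p - q + 1)"
    using n(1) q p10 k by (intro abs_leI; (simp only: distrib_left right_diff_distrib)?; linarith)
  have d: "\<bar>8 * k + 6 * p + 9\<bar> \<le> 2 * (8 * k + 6 * p + 1)"
    using n(1) q p10 k by (intro abs_leI; (simp only: distrib_left right_diff_distrib)?; linarith)
  have pos: "s + 2 > 0" "s + 1 > 0" "k + 1 > 0" "k + p - q + 1 > 0" "8 * k + 6 * p + 1 > 0"
    using n(1) q p10 k unfolding s_def by linarith+
  define D where "D = 9 * ((k + 1) * (s + 1)) * (s + 2) * (k + p - q + 1) * (8 * k + 6 * p + 1)"
  have D: "D > 0"
    using pos by (simp add: D_def)
  define N where "N = (k + 3 * p + 1/2) * ((k + 3 * q + 1/2) * (2 * k - 3 * q + 1/2))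
      * (2 * k - 3 * q + 3/2) * (8 * k + 6 * p + 9)"
  have "\<bar>N\<bar> = \<bar>k + 3 * p + 1/2\<bar> * \<bar>(k + 3 * q + 1/2) * (2 * k - 3 * q + 1/2)\<bar>
      * \<bar>2 * k - 3 * q + 3/2\<bar> * \<bar>8 * k + 6 * p + 9\<bar>"
    by (simp only: N_def abs_mult)
  also have "\<dots> \<le> 2 * (s + 2) * ((k + 1) * (s + 1)) * (2 * (k + p - q + 1)) * (2 * (8 * k + 6 * p + 1))"
    using pos by (intro mult_mono a b c d mult_nonneg_nonneg) auto
  also have "\<dots> = 8/9 * D"
    unfolding D_def by algebra
  finally have "\<bar>N / D\<bar> \<le> 8/9"
    using D by (simp add: divide_le_eq)
  moreover have "ratio p q k * ((8 * k + 6 * p + 9) / (8 * k + 6 * p + 1)) = N / D"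
    unfolding ratio_def N_def D_def s_def by (simp add: mult_ac) (simp add: algebra_simps)
  ultimately show ?thesis
    by simp
qed

text \<open>Comparison with a geometric series of ratio 8/9 starting at k = 1; the constant is 1/(1
  - 8/9) = 9.\<close>

lemma suminf_summand_tail:
  assumes "9 * (\<bar>q\<bar> + 1)^2 + (\<bar>q\<bar> + 1) \<le> p"
  shows "\<bar>suminf (summand p q) - summand p q 0\<bar> \<le> 9 * \<bar>summand p q 1\<bar>"
proof -
  have pq: "\<bar>q\<bar> \<le> p"
    using assms by (smt (verit) zero_le_power2)
  have "real_of_int (9 * (\<bar>q\<bar> + 1)^2 + (\<bar>q\<bar> + 1)) \<le> real_of_int p"
    using assms by (simp only: of_int_le_iff)
  hence le: "\<bar>summand p q (Suc k)\<bar> \<le> 8/9 * \<bar>summand p q k\<bar>" for k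
    unfolding summand_Suc[OF pq] abs_mult[of _ "summand p q k"]
    by (intro mult_right_mono abs_ratio_le[where n = "\<bar>of_int q\<bar> + 1"]) auto
  have geo: "\<bar>summand p q (Suc k)\<bar> \<le> \<bar>summand p q 1\<bar> * (8/9) ^ k" for k
  proof (induction k)
    case (Suc k)
    show ?case
      using le[of "Suc k"] Suc by simp
  qed simp
  have "suminf (summand p q) - summand p q 0 = (\<Sum>k. summand p q (Suc k))"
    by (simp add: suminf_split_head[OF summable_summand[OF pq]])
  also have "\<bar>\<dots>\<bar> \<le> (\<Sum>k. \<bar>summand p q 1\<bar> * (8/9) ^ k)"
    unfolding real_norm_def [symmetric]
    by (rule norm_suminf_le) (use geo in \<open>auto intro!: summable_mult summable_geometric\<close>)
  also have "\<dots> = 9 * \<bar>summand p q 1\<bar>"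
    by (simp add: suminf_mult suminf_geometric summable_geometric)
  finally show ?thesis .
qed

section \<open>Asymptotics of the term at k = 0\<close>

text \<open>Gauss's limit for Gamma (a - 1), with the Pochhammer symbol in it rewritten as Gamma (n
  + a) / Gamma (a - 1). As a > 1, the point a - 1 is positive and no pole.\<close>

lemma Gamma_fact_powr_tendsto_1:
  fixes a :: real
  assumes "a > 1"
  shows "(\<lambda>n. Gamma (real n + a) / (fact n * real n powr (a - 1))) \<longlonglongrightarrow> 1"
proof -
  have nz: "Gamma (a - 1) \<noteq> 0"
    using assms by (simp add: less_imp_neq[symmetric])
  have "(\<lambda>n. Gamma (a - 1) / Gamma_series (a - 1) n) \<longlonglongrightarrow> Gamma (a - 1) / Gamma (a - 1)"
    using nz by (intro tendsto_intros)
  moreover have "eventually (\<lambda>n. Gamma (a - 1) / Gamma_series (a - 1) n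
      = Gamma (real n + a) / (fact n * real n powr (a - 1))) sequentially"
    \<comment> \<open>n = 0 is excluded since 0 \<open>powr\<close> anything is 0, while
      \<open>Gamma_series\<close> contains the exponential of a logarithm.\<close>
    using eventually_gt_at_top[of 0]
  proof eventually_elim
    case (elim n)
    have "a - 1 \<notin> \<int>\<^sub>\<le>\<^sub>0"
      using assms by (auto elim: nonpos_Ints_cases)
    from pochhammer_Gamma[OF this, of "n + 1"]
    have "pochhammer (a - 1) (n + 1) = Gamma (real n + a) / Gamma (a - 1)"
      by (simp add: algebra_simps)
    thus ?case
      using elim nz by (simp add: Gamma_series_def powr_def)
  qed
  ultimately show ?thesis
    using nz by (simp add: tendsto_cong)
qed

text \<open>The factorials n! and (3n)! cancel, and \<open>balance\<close> says that the powers of n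
  cancel too, with one power coming from the linear factor. What survives is 6 and the power of 3
  left by the arguments 3n.\<close>

lemma Gamma_quotient_tendsto:
  fixes a b c d e :: real
  assumes gt: "a > 1" "b > 1" "d > 1" "e > 1" and balance: "a + b + 1 = d + e"
  shows "(\<lambda>n. Gamma (real n + a) * Gamma (real (3 * n) + b) * (6 * real n + c)
    / (Gamma (real n + d) * Gamma (real (3 * n) + e))) \<longlonglongrightarrow> 6 * 3 powr (b - e)"
proof -
  define g where "g x n = Gamma (real n + x) / (fact n * real n powr (x - 1))" for x :: real and n
  have g: "g x \<longlonglongrightarrow> 1" if "x > 1" for x
    using Gamma_fact_powr_tendsto_1[OF that] by (simp add: g_def[abs_def])
  have mono: "strict_mono (\<lambda>n::nat. 3 * n)"
    by (auto simp: strict_mono_def)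
  have g3: "(\<lambda>n. g x (3 * n)) \<longlonglongrightarrow> 1" if "x > 1" for x
    using LIMSEQ_subseq_LIMSEQ[OF g[OF that] mono] by (simp add: o_def)
  have "(\<lambda>n. (6 * real n + c) / real n) \<longlonglongrightarrow> 6"
    by real_asymp
  hence "(\<lambda>n. g a n * g b (3 * n) / (g d n * g e (3 * n)) * ((6 * real n + c) / real n) * 3 powr (b - e))
      \<longlonglongrightarrow> 1 * 1 / (1 * 1) * 6 * 3 powr (b - e)"
    using gt by (intro tendsto_intros g g3) auto
  moreover have "eventually (\<lambda>n. g a n * g b (3 * n) / (g d n * g e (3 * n)) * ((6 * real n + c) / real n) * 3 powr (b - e)
      = Gamma (real n + a) * Gamma (real (3 * n) + b) * (6 * real n + c)
        / (Gamma (real n + d) * Gamma (real (3 * n) + e))) sequentially"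
    using eventually_gt_at_top[of 0]
  proof eventually_elim
    case (elim n)
    have "real n powr (a - 1) * real (3 * n) powr (b - 1) * real n
        = real n powr (a - 1 + (b - 1) + 1) * 3 powr (b - 1)"
      using elim by (simp add: powr_mult powr_add powr_diff mult_ac power2_eq_square)
    also have "a - 1 + (b - 1) + 1 = (d - 1) + (e - 1)"
      using balance by simp
    also have "real n powr ((d - 1) + (e - 1)) * 3 powr (b - 1)
        = real n powr (d - 1) * real (3 * n) powr (e - 1) * 3 powr (b - e)"
      using elim by (simp add: powr_mult powr_add powr_diff mult_ac power2_eq_square)
    finally have powers: "real n powr (a - 1) * real (3 * n) powr (b - 1) * real n
        = real n powr (d - 1) * real (3 * n) powr (e - 1) * 3 powr (b - e)" .
    have "3 powr (b - e) / (real n powr (a - 1) * real (3 * n) powr (b - 1) * real n)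
        = 1 / (real n powr (d - 1) * real (3 * n) powr (e - 1))"
      unfolding powers using elim by simp
    \<comment> \<open>The quotient is multiplied by a factor equal to 1, which is what unfolding
      \<open>g\<close> produces.\<close>
    hence "Gamma (real n + a) * Gamma (real (3 * n) + b) * (6 * real n + c) / (Gamma (real n + d) * Gamma (real (3 * n) + e))
        * (real n powr (d - 1) * real (3 * n) powr (e - 1)) * (3 powr (b - e) / (real n powr (a - 1) * real (3 * n) powr (b - 1) * real n))
      = Gamma (real n + a) * Gamma (real (3 * n) + b) * (6 * real n + c) / (Gamma (real n + d) * Gamma (real (3 * n) + e))"
      using elim by simp
    thus ?case
      by (simp add: g_def mult_ac)
  qed
  ultimately show ?thesis
    by (simp add: tendsto_cong)
qed

text \<open>At k = 0 the two Gamma factors free of p are a reflection pair with index 3q. The others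
  form a balanced quotient. The offset 2\<bar>q\<bar> + 1 makes all four of its Gamma shifts exceed
  1.\<close>

lemma summand_0_tendsto:
  "(\<lambda>n. summand (int n + (2 * \<bar>q\<bar> + 1)) q 0) \<longlonglongrightarrow> 2 * pi * (-1) powi q * 3 powr (1/2 - 3 * of_int q)"
proof -
  define M where "M = 2 * \<bar>q\<bar> + 1"
  define m Q where "m = real_of_int M" and "Q = real_of_int q"
  have M: "M \<ge> 1" "M + 2 * q \<ge> 1" "M - q \<ge> 1" "M + q \<ge> 1"
    unfolding M_def by auto
  hence m: "m \<ge> 1" "m + 2 * Q \<ge> 1" "m - Q \<ge> 1" "m + Q \<ge> 1"
    unfolding m_def Q_def by linarith+
  have Gam: "fact (nat i) = Gamma (real_of_int i + 1)" if "i \<ge> 0" for i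
    using Gamma_fact[of "nat i", where 'a = real] that by (simp add: add_ac)
  have eq: "summand (int n + M) q 0 = gamma_half (3 * q) * gamma_half (- (3 * q)) *
      (Gamma (real n + (m + 2 * Q + 1/2)) * Gamma (real (3 * n) + (3 * m + 1/2)) * (6 * real n + (6 * m + 1))
       / (Gamma (real n + (m - Q + 1)) * Gamma (real (3 * n) + (3 * m + 3 * Q + 1))))" for n
  proof -
    have "fact (nat (int n + M - q)) = Gamma (real n + (m - Q + 1))"
      "fact (nat (3 * (int n + M) + 3 * q)) = Gamma (real (3 * n) + (3 * m + 3 * Q + 1))"
      using M by (subst Gam; simp add: m_def Q_def algebra_simps)+
    moreover have "gamma_half (int n + M + 2 * q) = Gamma (real n + (m + 2 * Q + 1/2))"
      "gamma_half (3 * (int n + M)) = Gamma (real (3 * n) + (3 * m + 1/2))"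
      by (simp_all add: gamma_half_def m_def Q_def algebra_simps)
    ultimately show ?thesis
      by (simp add: summand_def base_term_def m_def algebra_simps)
  qed
  have lim: "(\<lambda>n. gamma_half (3 * q) * gamma_half (- (3 * q)) *
      (Gamma (real n + (m + 2 * Q + 1/2)) * Gamma (real (3 * n) + (3 * m + 1/2)) * (6 * real n + (6 * m + 1))
       / (Gamma (real n + (m - Q + 1)) * Gamma (real (3 * n) + (3 * m + 3 * Q + 1)))))
      \<longlonglongrightarrow> gamma_half (3 * q) * gamma_half (- (3 * q)) * (6 * 3 powr ((3 * m + 1/2) - (3 * m + 3 * Q + 1)))"
    using m by (intro tendsto_mult_left Gamma_quotient_tendsto) auto
  \<comment> \<open>3q and q have the same parity.\<close>
  have "gamma_half (3 * q) * gamma_half (- (3 * q)) = pi * (-1) powi q"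
    by (simp add: gamma_half_reflection power_int_minus_left)
  moreover have "6 * 3 powr ((3 * m + 1/2) - (3 * m + 3 * Q + 1)) = 2 * (3 powr (1/2 - 3 * Q) :: real)"
  proof -
    have "(3 * m + 1/2) - (3 * m + 3 * Q + 1) = (1/2 - 3 * Q) - 1"
      by simp
    thus ?thesis
      by (simp only: powr_diff) simp
  qed
  ultimately have "gamma_half (3 * q) * gamma_half (- (3 * q)) * (6 * 3 powr ((3 * m + 1/2) - (3 * m + 3 * Q + 1)))
      = 2 * pi * (-1) powi q * 3 powr (1/2 - 3 * Q)"
    by (simp only: mult_ac)
  with lim show ?thesis
    unfolding M_def [symmetric] eq Q_def by (simp only:)
qed

section \<open>Value of the series\<close>

lemma suminf_summand:
  assumes "\<bar>q\<bar> \<le> p"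
  shows "suminf (summand p q) = 2 * pi * (-1) powi q * 3 powr (1/2 - 3 * of_int q)"
proof -
  define M where "M = 2 * \<bar>q\<bar> + 1"
  define L where "L = 2 * pi * (-1) powi q * 3 powr (1/2 - 3 * real_of_int q)"
  define S where "S = suminf (summand p q)"
  \<comment> \<open>Starting from p and from M + n, upward shifts meet at p + M + n, whichever of
    the two is larger.\<close>
  have const: "suminf (summand (int n + M) q) = S" for n
    using suminf_summand_add[of q p "nat (M + int n)"] suminf_summand_add[of q "M + int n" "nat p"]
      assms by (simp add: S_def M_def add_ac split: if_splits)
  have head: "(\<lambda>n. summand (int n + M) q 0) \<longlonglongrightarrow> L"
    unfolding M_def L_def by (rule summand_0_tendsto)
  \<comment> \<open>At k = 0 the numerator of \<open>ratio\<close> has degree 1 in p and the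
    denominator degree 3. Multiplied by the convergent head, this makes the term at k = 1 vanish in
    the limit.\<close>
  have "(\<lambda>n. ratio (real n + of_int M) (of_int q) 0
      * ((6 * (real n + of_int M) + 9) / (6 * (real n + of_int M) + 1))) \<longlonglongrightarrow> 0"
    unfolding ratio_def by real_asymp
  from tendsto_mult[OF this head]
  have "(\<lambda>n. summand (int n + M) q 1) \<longlonglongrightarrow> 0"
    using summand_Suc[of q "int _ + M" 0] by (simp add: M_def)
  hence null: "(\<lambda>n. 9 * \<bar>summand (int n + M) q 1\<bar>) \<longlonglongrightarrow> 0"
    by (intro tendsto_mult_right_zero tendsto_rabs_zero)
  have "(\<lambda>n. S - summand (int n + M) q 0) \<longlonglongrightarrow> 0"
  proof (rule Lim_null_comparison[OF _ null])
    show "eventually (\<lambda>n. norm (S - summand (int n + M) q 0) \<le> 9 * \<bar>summand (int n + M) q 1\<bar>) sequentially"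
      using eventually_ge_at_top[of "nat (9 * (\<bar>q\<bar> + 1)^2 + (\<bar>q\<bar> + 1))"]
    proof eventually_elim
      case (elim n)
      hence "9 * (\<bar>q\<bar> + 1)^2 + (\<bar>q\<bar> + 1) \<le> int n + M"
        by (simp add: M_def)
      from suminf_summand_tail[OF this] show ?case
        by (simp add: const)
    qed
  qed
  hence "(\<lambda>n. summand (int n + M) q 0) \<longlonglongrightarrow> S"
    using tendsto_diff[OF tendsto_const[of S]] by fastforce
  from LIMSEQ_unique[OF this head] show ?thesis
    by (simp add: S_def L_def)
qed

section \<open>Passage to complex shifted factorials\<close>

lemma shifted_factorial_half:
  "shifted_factorial (1/2) n = complex_of_real (gamma_half n / sqrt pi)"
proof -
  have "1/2 + of_int n = complex_of_real (of_int n + 1/2)"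
    by simp
  thus ?thesis
    by (simp only: shifted_factorial_def gamma_half_def Gamma_complex_of_real
        Gamma_one_half_complex of_real_divide)
qed

theorem theorem5:
  fixes p q :: int
  assumes "min (p + q) (p - q) \<ge> 0"
  defines "t \<equiv> (\<lambda>k::nat.
      shifted_factorial (1/2) (int k + 3 * p) * shifted_factorial (1/2) (int k + 3 * q)
        * shifted_factorial (1/2) (2 * int k - 3 * q)
      / (fact k * fact (nat (int k + p - q)) * fact (nat (2 * int k + 3 * p + 3 * q)))
      * (of_int (8 * int k + 6 * p + 1) / 9 ^ k))"
  shows "summable t \<and>
    2 * (-1) powi q / (3 powr (3 * of_int q - 1/2) * complex_of_real pi)
      = shifted_factorial (1/2) (p + 2 * q) * (\<Sum>k. t k)"
proof -
  have pq: "\<bar>q\<bar> \<le> p"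
    using assms(1) by auto
  define c where "c = sqrt pi"
  have c: "c \<noteq> 0" "c ^ 2 = pi"
    by (simp_all add: c_def)
  have factorial: "shifted_factorial (1/2) n = complex_of_real (gamma_half n / c)" for n
    by (simp add: shifted_factorial_half c_def)
  \<comment> \<open>Undoes the normalisation of \<open>base_term\<close>: the absorbed prefactor,
    and one \<open>sqrt pi\<close> for each of the three shifted factorials in
    \<open>t\<close>.\<close>
  define C where "C = gamma_half (p + 2 * q) * c ^ 3"
  have t: "t k = complex_of_real (summand p q k / C)" for k
    by (simp add: t_def C_def summand_def base_term_def factorial gamma_half_nonzero c(1)
        power3_eq_cube mult.assoc)
  have "(\<lambda>k. summand p q k / C) sums (suminf (summand p q) / C)"
    by (intro sums_divide summable_sums summable_summand pq)
  hence sums: "t sums complex_of_real (suminf (summand p q) / C)"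
    unfolding t by (rule sums_of_real)
  have "2 * (-1) powi q / (3 powr (3 * of_int q - 1/2) * complex_of_real pi)
      = complex_of_real (2 * (-1) powi q / (3 powr (3 * of_int q - 1/2) * pi))"
    using powr_of_real[of 3 "3 * of_int q - 1/2"] by simp
  also have "2 * (-1) powi q / (3 powr (3 * of_int q - 1/2) * pi)
      = 2 * (-1) powi q * 3 powr (1/2 - 3 * real_of_int q) / pi"
    using powr_minus_divide[of 3 "3 * of_int q - 1/2 :: real"] by simp
  also have "\<dots> = suminf (summand p q) / pi ^ 2"
    by (simp add: suminf_summand[OF pq] power2_eq_square)
  \<comment> \<open>The prefactor brings the fourth \<open>sqrt pi\<close>, and c^4 = pi^2.\<close>
  also have "\<dots> = gamma_half (p + 2 * q) / c * (suminf (summand p q) / C)"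
    using c(1) by (simp add: C_def gamma_half_nonzero power2_eq_square power3_eq_cube flip: c(2))
  finally show ?thesis
    using sums by (simp add: sums_iff factorial)
qed

end
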